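(* Let $N\in\mathbb{N}$ (so $N\geq 1$), let $\{r_i\}_{i=1}^N$ be a collection of real numbers, and let $0<\delta<\frac{3^{1-N}}{18}$. Then $\bigcap_{i=1}^N\left(\mathbf{Bad}(\delta)+r_i\right)$ is a dense subset of $\mathbb{R}$, and, moreover, $$\dim_H\left(\bigcap_{i=1}^N\left(\mathbf{Bad}(\delta)+r_i\right)\right)\ge \frac{N\log\left(\left\lfloor\left(\frac{1}{18\delta\cdot 3^{N-1}}\right)^{1/N}\right\rfloor\right)}{\log\left(\frac1{6\delta}\right)}.$$
   Context: $\dim_H$ denotes Hausdorff dimension and $\lfloor\cdot\rfloor$ the floor function. For $\delta>0$, $\mathbf{Bad}(\delta)$ denotes the set of irrational real numbers $x$ for which there exists an integer $Q>0$ (depending on $x$) such that $|x-p/q|\ge \delta/q^2$ for all integers $q\ge Q$ and all integers $p$ coprime to $q$. For $E\subset\mathbb{R}$ and $r\in\mathbb{R}$, $E+r=\{x+r:x\in E\}$. *)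

theory Defs
  imports "HOL-Analysis.Analysis"
begin

text \<open>
  The gauge \<open>U \<mapsto> |U| ^ s\<close> with the usual conventions that the empty set
  contributes 0 and that \<open>|U| ^ 0 = 1\<close> for nonempty \<open>U\<close>.
  The case \<open>s = 0\<close> is separate because \<open>0 powr 0 = 0\<close> in the library.
\<close>

definition hausdorff_gauge :: "real \<Rightarrow> 'a::metric_space set \<Rightarrow> ennreal" where
  "hausdorff_gauge s U =
     (if U = {} then 0 else if s = 0 then 1 else ennreal (diameter U powr s))"

text \<open>
  Boundedness of the covering sets is required explicitly because \<^const>\<open>diameter\<close>
  is real-valued and carries no meaning on unbounded sets.
  Finite covers are included, since the sets \<open>U i\<close> may be empty.
\<close>

definition hausdorff_premeasure :: "real \<Rightarrow> real \<Rightarrow> 'a::metric_space set \<Rightarrow> ennreal" where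
  "hausdorff_premeasure s d E =
     Inf {(\<Sum>i. hausdorff_gauge s (U i)) | U :: nat \<Rightarrow> 'a set.
            E \<subseteq> (\<Union>i. U i) \<and> (\<forall>i. bounded (U i) \<and> diameter (U i) \<le> d)}"

definition hausdorff_measure :: "real \<Rightarrow> 'a::metric_space set \<Rightarrow> ennreal" where
  "hausdorff_measure s E = (SUP d\<in>{0<..}. hausdorff_premeasure s d E)"

definition hausdorff_dim :: "'a::metric_space set \<Rightarrow> ereal" where
  "hausdorff_dim E = Inf {ereal s | s. 0 \<le> s \<and> hausdorff_measure s E = 0}"

definition Bad :: "real \<Rightarrow> real set" where
  "Bad \<delta> = {x. x \<notin> \<rat> \<and>
     (\<exists>Q::int. Q > 0 \<and>
        (\<forall>q p :: int. q \<ge> Q \<longrightarrow> coprime p q \<longrightarrow>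
           \<bar>x - of_int p / of_int q\<bar> \<ge> \<delta> / (of_int q)\<^sup>2))}"

definition translate :: "real set \<Rightarrow> real \<Rightarrow> real set" where
  "translate E r = {x + r | x. x \<in> E}"

end

theory Submission
  imports Defs
begin

text \<open>
  Fix a translate \<open>r\<close> and an interval \<open>I\<close> of length \<open>L\<close>. Distinct rationals whose denominators
  satisfy \<open>6 \<delta> \<le> L q\<^sup>2 \<le> 1\<close> are at distance at least \<open>L\<close>, and their danger zones have radius
  \<open>\<delta> / q\<^sup>2 \<le> L / 6\<close>; hence one of the three thirds of \<open>I\<close> avoids all danger zones. Cut this third
  into \<open>M\<close> equal pieces, \<open>M\<close> being the integer part in the bound, and go on with the next translate. After \<open>N\<close> steps the length has
  dropped by \<open>(3 M) ^ N \<le> 1 / (6 \<delta>)\<close>, so the ranges of denominators treated for one translate leave no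
  gap. The resulting Cantor set lies in the intersection; as fractions need not be reduced,
  irrationality comes for free. Its natural parametrization by \<open>[0, 1]\<close> has an inverse that is
  Hoelder continuous of exponent \<open>ln M / ln (3 M)\<close>, which bounds the dimension from below by
  comparison with Lebesgue measure.
\<close>

section \<open>Dimension of Cantor sets\<close>

lemma hausdorff_dim_geI:
  assumes "\<And>s. 0 \<le> s \<Longrightarrow> s < t \<Longrightarrow> hausdorff_measure s E \<noteq> 0"
  shows "ereal t \<le> hausdorff_dim E"
  unfolding hausdorff_dim_def
proof (rule Inf_greatest)
  fix z assume "z \<in> {ereal s | s. 0 \<le> s \<and> hausdorff_measure s E = 0}"
  then show "ereal t \<le> z" using assms by force
qed

lemma hausdorff_dim_nonneg: "0 \<le> hausdorff_dim E"
  using hausdorff_dim_geI[of 0 E] by (simp add: zero_ereal_def)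

text \<open>
  At level \<open>m\<close> the cells are \<open>[A m j, A m j + l / b ^ m]\<close>; cell \<open>j\<close> of level \<open>m + 1\<close> is a child of
  cell \<open>j div M\<close>. The index \<open>j\<close> ranges over all naturals, so level 0 already has infinitely
  many cells.
\<close>

locale cell_tree =
  fixes M :: nat and b l :: real and A :: "nat \<Rightarrow> nat \<Rightarrow> real"
  assumes M_pos: "1 \<le> M" and b_gt_1: "1 < b" and l_pos: "0 < l"
    and separated: "i < j \<Longrightarrow> A m i + l / b ^ m \<le> A m j"
    and child_ge: "A m (j div M) \<le> A (Suc m) j"
    and child_le: "A (Suc m) j + l / b ^ Suc m \<le> A m (j div M) + l / b ^ m"
begin

text \<open>The base-\<open>M\<close> digits of \<open>t\<close> choose the children, and the
  integer part of \<open>t\<close> chooses the root. For \<open>t = 1\<close> the index is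
  \<open>M ^ m\<close>, under root 1: having infinitely many roots spares a special case at the
  right end of \<open>[0, 1]\<close>.\<close>

definition cell_index :: "real \<Rightarrow> nat \<Rightarrow> nat" where
  "cell_index t m = nat \<lfloor>t * real M ^ m\<rfloor>"

text \<open>For \<open>t \<ge> 0\<close> this is the unique common point of the nested cells
  belonging to \<open>t\<close>, as their lengths tend to 0.\<close>

definition point :: "real \<Rightarrow> real" where
  "point t = (SUP m. A m (cell_index t m))"

lemma cell_index_Suc_div: "0 \<le> t \<Longrightarrow> cell_index t (Suc m) div M = cell_index t m"
proof -
  assume t: "0 \<le> t"
  have "\<lfloor>t * real M ^ Suc m / of_int (int M)\<rfloor> = \<lfloor>t * real M ^ Suc m\<rfloor> div int M"
    by (rule floor_divide_real_eq_div) simp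
  moreover have "t * real M ^ Suc m / of_int (int M) = t * real M ^ m"
    using M_pos by simp
  ultimately show ?thesis
    unfolding cell_index_def using t by (simp add: nat_div_distrib)
qed

lemma left_end_mono:
  assumes "0 \<le> t" "m \<le> n"
  shows "A m (cell_index t m) \<le> A n (cell_index t n)"
  using assms(2)
proof (induction n rule: dec_induct)
  case (step n)
  with child_ge[of n "cell_index t (Suc n)"] show ?case
    by (simp add: cell_index_Suc_div[OF assms(1)])
qed simp

lemma right_end_antimono:
  assumes "0 \<le> t" "m \<le> n"
  shows "A n (cell_index t n) + l / b ^ n \<le> A m (cell_index t m) + l / b ^ m"
  using assms(2)
proof (induction n rule: dec_induct)
  case (step n)
  with child_le[of n "cell_index t (Suc n)"] show ?case
    by (simp add: cell_index_Suc_div[OF assms(1)])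
qed simp

lemma left_end_le_right_end:
  assumes "0 \<le> t"
  shows "A m (cell_index t m) \<le> A n (cell_index t n) + l / b ^ n"
proof -
  have pos: "0 < l / b ^ k" for k
    using b_gt_1 l_pos by simp
  show ?thesis
    using left_end_mono[OF assms, of m n] right_end_antimono[OF assms, of n m] pos[of m] pos[of n]
    by (cases "m \<le> n") auto
qed

lemma point_in_cell:
  assumes "0 \<le> t"
  shows "A m (cell_index t m) \<le> point t" "point t \<le> A m (cell_index t m) + l / b ^ m"
proof -
  have "bdd_above (range (\<lambda>m. A m (cell_index t m)))"
    using left_end_le_right_end[OF assms, of _ 0] by (intro bdd_aboveI) auto
  then show "A m (cell_index t m) \<le> point t"
    unfolding point_def by (intro cSUP_upper) auto
  show "point t \<le> A m (cell_index t m) + l / b ^ m"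
    unfolding point_def by (intro cSUP_least left_end_le_right_end assms) auto
qed

text \<open>Adjacent cells may touch, so indices differing by 1 give no gap. The factor 2 makes them
  differ by at least 2, and a whole cell fits in between.\<close>

lemma point_separated:
  assumes "0 \<le> t" "2 / real M ^ m \<le> u - t"
  shows "point t + l / b ^ m \<le> point u"
proof -
  have Mm: "0 < real M ^ m"
    using M_pos by simp
  have "2 \<le> (u - t) * real M ^ m"
    using assms(2) Mm by (simp add: pos_divide_le_eq)
  then have "\<lfloor>t * real M ^ m\<rfloor> + 2 \<le> \<lfloor>u * real M ^ m\<rfloor>"
    by (simp add: le_floor_iff algebra_simps) linarith
  then have less: "Suc (cell_index t m) < cell_index u m"
    unfolding cell_index_def using assms(1) by (smt (verit) Suc_nat_eq_nat_zadd1 Mm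
      mult_nonneg_nonneg zero_le_floor zless_nat_conj)
  have u: "0 \<le> u"
    using assms Mm by (smt (verit) divide_pos_pos)
  show ?thesis
    using point_in_cell(2)[OF assms(1), of m] point_in_cell(1)[OF u, of m]
      separated[of "cell_index t m" "Suc (cell_index t m)" m] separated[OF less, of m]
    by simp
qed

text \<open>Apply \<open>point_separated\<close> at the first level \<open>m\<close> with
  \<open>2 / M ^ m \<le> u - t\<close>. Minimality gives the converse estimate up to a factor
  \<open>M\<close>, and the exponent is the one that turns \<open>1 / b ^ m\<close> into
  \<open>1 / M ^ m\<close>.\<close>

lemma parameter_holder:
  assumes M: "2 \<le> M" and t: "0 \<le> t" "t < u" "u \<le> 1"
  shows "point t \<le> point u" "u - t \<le> 2 * real M * ((point u - point t) / l) powr (ln (real M) / ln b)"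
proof -
  let ?s = "ln (real M) / ln b"
  let ?P = "\<lambda>m. 2 / real M ^ m \<le> u - t"
  have "\<exists>m. 2 / (u - t) < real M ^ m"
    using M by (intro real_arch_pow) simp
  then obtain m0 where "2 / (u - t) < real M ^ m0" ..
  then have P0: "?P m0"
    using t M by (simp add: field_simps)
  define m where "m = (LEAST m. ?P m)"
  have Pm: "?P m"
    unfolding m_def by (rule LeastI[of ?P, OF P0])
  \<comment> \<open>Level 0 would require \<open>2 \<le> u - t\<close>, but both parameters lie in
    \<open>[0, 1]\<close>.\<close>
  have "m \<noteq> 0"
    using Pm t by (intro notI) simp
  then obtain k where k: "m = Suc k"
    by (cases m) auto
  have "\<not> ?P k"
    using not_less_Least[of k ?P] k unfolding m_def by simp
  then have h: "u - t \<le> 2 * real M * (1 / real M ^ m)"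
    using M by (simp add: k)
  have sep: "point t + l / b ^ m \<le> point u"
    by (rule point_separated[OF t(1) Pm])
  have bm: "0 < b ^ m"
    using b_gt_1 by simp
  show "point t \<le> point u"
    using sep l_pos bm by (smt (verit) divide_pos_pos)
  have "1 / real M ^ m = (1 / b ^ m) powr ?s"
  proof -
    have "(1 / b ^ m) powr ?s = exp (?s * - (real m * ln b))"
      using b_gt_1 by (simp add: powr_def ln_div ln_realpow)
    also have "?s * - (real m * ln b) = - (real m * ln (real M))"
      using b_gt_1 by simp
    also have "exp \<dots> = 1 / real M ^ m"
      using M by (simp add: exp_minus exp_of_nat_mult field_simps)
    finally show ?thesis ..
  qed
  also have "\<dots> \<le> ((point u - point t) / l) powr ?s"
    using sep l_pos b_gt_1 M bm
    by (intro powr_mono2) (auto simp: field_simps)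
  finally show "u - t \<le> 2 * real M * ((point u - point t) / l) powr ?s"
    using h by (meson mult_left_mono of_nat_0_le_iff order_trans zero_le_mult_iff zero_le_numeral)
qed

lemma parameter_dist_le_gauge:
  assumes M: "2 \<le> M" and s: "0 \<le> s" "s \<le> ln (real M) / ln b"
    and t: "t \<in> {0..1}" "point t \<in> U" and u: "u \<in> {0..1}" "point u \<in> U"
    and U: "bounded U" "diameter U \<le> l"
  shows "ennreal \<bar>u - t\<bar> \<le> ennreal (2 * real M * l powr (-s)) * hausdorff_gauge s U"
  using t u
proof (induction t u rule: linorder_wlog)
  case (le t u)
  let ?e = "ln (real M) / ln b"
  consider "u = t" | "s = 0" | "t < u" "s > 0"
    using le(1) s by linarith
  then show ?case
  proof cases
    case 1
    then show ?thesis by simp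
  next
    \<comment> \<open>At exponent 0 a nonempty set has gauge 1 even if its diameter is 0, so the
      trivial bound \<open>u - t \<le> 1\<close> is enough.\<close>
    case 2
    have "\<bar>u - t\<bar> \<le> 2 * real M" using le M by auto
    then show ?thesis
      using 2 le l_pos by (auto simp: hausdorff_gauge_def intro!: ennreal_leI)
  next
    case 3
    have hol: "point t \<le> point u" "u - t \<le> 2 * real M * ((point u - point t) / l) powr ?e"
      using parameter_holder[OF M, of t u] 3 le by auto
    have diam: "point u - point t \<le> diameter U"
      using diameter_bounded_bound[OF U(1) le(5) le(3)] by (simp add: dist_real_def)
    \<comment> \<open>The base is at most 1 because \<open>diameter U \<le> l\<close>; lowering the
      exponent can only increase the power.\<close>
    have "((point u - point t) / l) powr ?e \<le> ((point u - point t) / l) powr s"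
      using hol(1) diam U(2) l_pos s by (intro powr_mono') auto
    also have "\<dots> \<le> (diameter U / l) powr s"
      using hol(1) diam l_pos s by (intro powr_mono2 divide_right_mono) auto
    also have "\<dots> = l powr (-s) * diameter U powr s"
      using l_pos diameter_ge_0[OF U(1)] by (simp add: powr_divide powr_minus field_simps)
    finally have "u - t \<le> 2 * real M * (l powr (-s) * diameter U powr s)"
      using hol(2) by (meson mult_left_mono of_nat_0_le_iff order_trans zero_le_mult_iff zero_le_numeral)
    then have "ennreal \<bar>u - t\<bar> \<le> ennreal (2 * real M * l powr (-s) * diameter U powr s)"
      using 3 by (intro ennreal_leI) (simp add: mult.assoc)
    then show ?thesis
      using le 3 by (auto simp: hausdorff_gauge_def ennreal_mult)
  qed
next
  case (sym t u)
  then show ?case by (simp add: abs_minus_commute)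
qed

text \<open>Mass distribution: the parameter sets \<open>V i\<close> cover \<open>[0, 1]\<close>,
  and each sits in an interval of length at most \<open>2 * C\<close> times the gauge of
  \<open>U i\<close>. Lebesgue measure of \<open>[0, 1]\<close> then bounds the sum below. Passing
  to the sets \<open>J i\<close> avoids any question of measurability of \<open>V i\<close>.\<close>

lemma sum_gauge_ge:
  assumes M: "2 \<le> M" and s: "0 \<le> s" "s \<le> ln (real M) / ln b"
    and cov: "point ` {0..1} \<subseteq> (\<Union>i. U i)"
    and U: "\<And>i. bounded (U i)" "\<And>i. diameter (U i) \<le> l"
  shows "ennreal (1 / (4 * real M * l powr (-s))) \<le> (\<Sum>i::nat. hausdorff_gauge s (U i))"
proof -
  define C where "C = 2 * real M * l powr (-s)"
  have C: "0 < C" unfolding C_def using M l_pos by simp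
  define V where "V i = {t \<in> {0..1}. point t \<in> U i}" for i
  have "\<exists>J. J \<in> sets lborel \<and> V i \<subseteq> J \<and> emeasure lborel J \<le> ennreal (2 * C) * hausdorff_gauge s (U i)"
    for i
  proof (cases "V i = {} \<or> hausdorff_gauge s (U i) = \<infinity>")
    case True
    then show ?thesis
    proof
      assume "V i = {}"
      then show ?thesis by (intro exI[of _ "{}"]) auto
    next
      assume "hausdorff_gauge s (U i) = \<infinity>"
      then show ?thesis using C by (intro exI[of _ UNIV]) (auto simp: ennreal_mult_top)
    qed
  next
    case False
    then obtain t where t: "t \<in> V i" by auto
    obtain g where g: "0 \<le> g" "hausdorff_gauge s (U i) = ennreal g"
      using False by (cases "hausdorff_gauge s (U i)") auto
    have "V i \<subseteq> {t - C * g..t + C * g}"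
    proof
      fix u assume u: "u \<in> V i"
      have "ennreal \<bar>u - t\<bar> \<le> ennreal C * ennreal g"
        unfolding C_def g(2)[symmetric]
        using t u by (intro parameter_dist_le_gauge[OF M s]) (auto simp: V_def U)
      then have "\<bar>u - t\<bar> \<le> C * g"
        using C g(1) by (simp add: ennreal_mult[symmetric])
      then show "u \<in> {t - C * g..t + C * g}" by auto
    qed
    then show ?thesis
      using C g by (intro exI[of _ "{t - C * g..t + C * g}"])
        (auto simp: ennreal_mult[symmetric] algebra_simps)
  qed
  then obtain J where J: "\<And>i. J i \<in> sets lborel" "\<And>i. V i \<subseteq> J i"
    "\<And>i. emeasure lborel (J i) \<le> ennreal (2 * C) * hausdorff_gauge s (U i)"
    by metis
  have "{0..1} \<subseteq> (\<Union>i. J i)"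
  proof
    fix t :: real assume t: "t \<in> {0..1}"
    then obtain i where "point t \<in> U i" using cov by blast
    then show "t \<in> (\<Union>i. J i)" using t J(2)[of i] by (auto simp: V_def)
  qed
  then have "emeasure lborel {0..1::real} \<le> emeasure lborel (\<Union>i. J i)"
    using J(1) by (intro emeasure_mono sets.countable_UN) auto
  also have "\<dots> \<le> (\<Sum>i. emeasure lborel (J i))"
    using J(1) by (intro emeasure_subadditive_countably) auto
  also have "\<dots> \<le> (\<Sum>i. ennreal (2 * C) * hausdorff_gauge s (U i))"
    using J(3) by (intro suminf_le) auto
  also have "\<dots> = ennreal (2 * C) * (\<Sum>i. hausdorff_gauge s (U i))"
    by simp
  finally have "1 \<le> ennreal (2 * C) * (\<Sum>i. hausdorff_gauge s (U i))"
    by simp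
  then have "ennreal (1 / (2 * C)) * 1 \<le> ennreal (1 / (2 * C)) * (ennreal (2 * C) * (\<Sum>i. hausdorff_gauge s (U i)))"
    by (rule mult_left_mono) simp
  also have "\<dots> = (\<Sum>i. hausdorff_gauge s (U i))"
    using C by (simp add: mult.assoc[symmetric] ennreal_mult[symmetric])
  finally show ?thesis
    by (simp add: C_def mult.assoc)
qed

lemma hausdorff_dim_ge:
  assumes E: "point ` {0..1} \<subseteq> E"
  shows "ereal (ln (real M) / ln b) \<le> hausdorff_dim E"
proof (cases "M = 1")
  \<comment> \<open>The claimed bound is \<open>ln 1 / ln b = 0\<close>.\<close>
  case True
  then show ?thesis using hausdorff_dim_nonneg[of E] by (simp add: zero_ereal_def)
next
  case False
  then have M: "2 \<le> M" using M_pos by simp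
  show ?thesis
  proof (rule hausdorff_dim_geI)
    fix s assume s: "0 \<le> s" "s < ln (real M) / ln b"
    have "0 < ennreal (1 / (4 * real M * l powr (-s)))"
      using M l_pos by simp
    also have "\<dots> \<le> hausdorff_premeasure s l E"
      unfolding hausdorff_premeasure_def
      using sum_gauge_ge[OF M s(1) less_imp_le[OF s(2)]] E by (intro Inf_greatest) blast
    also have "\<dots> \<le> hausdorff_measure s E"
      unfolding hausdorff_measure_def using l_pos by (intro SUP_upper) auto
    finally show "hausdorff_measure s E \<noteq> 0" by simp
  qed
qed

end

section \<open>Avoiding danger zones\<close>

text \<open>If all three thirds fail, each has a point of \<open>S\<close> within
  \<open>L / 6\<close>. Points found for neighbouring thirds are less than \<open>L\<close> apart,
  hence equal, so a single point would lie on both sides of the midpoint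
  \<open>a + L / 2\<close>.\<close>

lemma free_third:
  fixes S :: "real set" and a L :: real
  assumes "0 < L" and sep: "\<And>x y. x \<in> S \<Longrightarrow> y \<in> S \<Longrightarrow> x \<noteq> y \<Longrightarrow> L \<le> \<bar>x - y\<bar>"
  shows "\<exists>c. a \<le> c \<and> c + L / 3 \<le> a + L \<and> (\<forall>x\<in>S. \<forall>y\<in>{c..c + L / 3}. L / 6 \<le> \<bar>y - x\<bar>)"
proof (rule ccontr)
  assume neg: "\<not> ?thesis"
  have ex: "\<exists>x\<in>S. c - L / 6 < x \<and> x < c + L / 2" if c: "a \<le> c" "c + L / 3 \<le> a + L" for c
  proof -
    obtain x y where "x \<in> S" "y \<in> {c..c + L / 3}" "\<not> L / 6 \<le> \<bar>y - x\<bar>"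
      using neg c by blast
    then have "c - L / 6 < x" "x < c + L / 2"
      unfolding atLeastAtMost_iff by argo+
    with \<open>x \<in> S\<close> show ?thesis by blast
  qed
  obtain x1 where x1: "x1 \<in> S" "a - L / 6 < x1" "x1 < a + L / 2"
    using ex[of a] assms(1) by auto
  obtain x2 where x2: "x2 \<in> S" "a + L / 6 < x2" "x2 < a + 5 * L / 6"
    using ex[of "a + L / 3"] assms(1) by (auto simp: field_simps)
  obtain x3 where x3: "x3 \<in> S" "a + L / 2 < x3" "x3 < a + 7 * L / 6"
    using ex[of "a + 2 * L / 3"] assms(1) by (auto simp: field_simps)
  have "x1 = x2" "x2 = x3"
    using sep[OF x1(1) x2(1)] sep[OF x2(1) x3(1)] x1 x2 x3 by argo+
  with x1 x3 show False by simp
qed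

text \<open>Distinct fractions differ by at least \<open>1 / (q * q')\<close>, and multiplying the
  two size conditions gives \<open>(L * q * q')\<^sup>2 \<le> 1\<close>.\<close>

lemma fraction_separated:
  fixes p q p' q' :: int and L :: real
  assumes q: "0 < q" "0 < q'" and ne: "of_int p / of_int q \<noteq> (of_int p' / of_int q' :: real)"
    and L: "0 < L" "L * (of_int q)\<^sup>2 \<le> 1" "L * (of_int q')\<^sup>2 \<le> 1"
  shows "L \<le> \<bar>of_int p / of_int q - of_int p' / of_int q'\<bar>"
proof -
  let ?q = "of_int q :: real" and ?q' = "of_int q' :: real"
  have pos: "0 < ?q" "0 < ?q'" using q by simp_all
  have "(of_int (p * q') :: real) \<noteq> of_int (p' * q)"
    using ne pos by (simp add: field_simps)
  then have "p * q' - p' * q \<noteq> 0"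
    by (metis eq_iff_diff_eq_0)
  then have "1 \<le> \<bar>p * q' - p' * q\<bar>" by linarith
  then have "1 \<le> \<bar>of_int p * ?q' - of_int p' * ?q\<bar>"
    by (metis of_int_1_le_iff of_int_abs of_int_diff of_int_mult)
  moreover have "\<bar>of_int p / ?q - of_int p' / ?q'\<bar> * (?q * ?q') = \<bar>of_int p * ?q' - of_int p' * ?q\<bar>"
    using pos by (simp add: diff_frac_eq abs_mult)
  moreover have "L * (?q * ?q') \<le> 1"
  proof -
    have "(L * (?q * ?q'))\<^sup>2 = (L * ?q\<^sup>2) * (L * ?q'\<^sup>2)"
      by (simp add: power2_eq_square)
    also have "\<dots> \<le> 1"
      using L by (intro mult_le_one[OF L(2) _ L(3)]) simp
    finally show ?thesis
      by (simp add: abs_square_le_1 abs_le_iff)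
  qed
  ultimately have "L * (?q * ?q') \<le> \<bar>of_int p / ?q - of_int p' / ?q'\<bar> * (?q * ?q')"
    by linarith
  then show ?thesis
    using pos by (simp add: mult_le_cancel_right)
qed

lemma third_avoiding_fractions:
  fixes a L r \<delta> :: real
  assumes L: "0 < L"
  shows "\<exists>c. a \<le> c \<and> c + L / 3 \<le> a + L \<and>
    (\<forall>y\<in>{c..c + L / 3}. \<forall>p q::int. 0 < q \<longrightarrow> 6 * \<delta> \<le> L * (of_int q)\<^sup>2 \<longrightarrow> L * (of_int q)\<^sup>2 \<le> 1 \<longrightarrow>
      \<delta> / (of_int q)\<^sup>2 \<le> \<bar>y - r - of_int p / of_int q\<bar>)"
proof -
  \<comment> \<open>Only the upper limit on \<open>q\<close> enters \<open>S\<close>, as it yields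
    the separation; the lower limit serves to bring the radius below \<open>L / 6\<close>.\<close>
  define S where "S = {r + of_int p / of_int q | p q :: int. 0 < q \<and> L * (of_int q)\<^sup>2 \<le> 1}"
  have "L \<le> \<bar>x - y\<bar>" if "x \<in> S" "y \<in> S" "x \<noteq> y" for x y
    using that fraction_separated[OF _ _ _ L] unfolding S_def by fastforce
  from free_third[OF L this, of S a] obtain c where c: "a \<le> c" "c + L / 3 \<le> a + L"
    "\<And>x y. x \<in> S \<Longrightarrow> y \<in> {c..c + L / 3} \<Longrightarrow> L / 6 \<le> \<bar>y - x\<bar>"
    by blast
  have "\<delta> / (of_int q)\<^sup>2 \<le> \<bar>y - r - of_int p / of_int q\<bar>"
    if y: "y \<in> {c..c + L / 3}" and q: "0 < q" "6 * \<delta> \<le> L * (of_int q)\<^sup>2" "L * (of_int q)\<^sup>2 \<le> 1"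
    for y and p q :: int
  proof -
    have "\<delta> / (of_int q)\<^sup>2 \<le> L / 6"
      using q by (simp add: field_simps)
    also have "\<dots> \<le> \<bar>y - (r + of_int p / of_int q)\<bar>"
      using q y by (intro c(3)) (auto simp: S_def)
    finally show ?thesis by (simp add: algebra_simps)
  qed
  with c(1,2) show ?thesis by blast
qed

section \<open>The Cantor set\<close>

lemma BadI:
  assumes Q: "0 < Q" and \<delta>: "0 < \<delta>"
    and avoid: "\<And>p q. Q \<le> q \<Longrightarrow> \<delta> / (of_int q)\<^sup>2 \<le> \<bar>x - of_int p / of_int q\<bar>"
  shows "x \<in> Bad \<delta>"
proof -
  have "x \<notin> \<rat>"
  proof
    assume "x \<in> \<rat>"
    then obtain p q :: int where x: "x = of_int p / of_int q" "0 < q"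
      by (auto elim!: Rats_cases')
    \<comment> \<open>Expanding the fraction by \<open>Q\<close> pushes its denominator past the
      threshold.\<close>
    have "x = of_int (p * Q) / of_int (q * Q)"
      using x Q by simp
    moreover have "Q \<le> q * Q"
      using x(2) Q by simp
    ultimately have "\<delta> / (of_int (q * Q))\<^sup>2 \<le> 0"
      using avoid[of "q * Q" "p * Q"] by simp
    moreover have "0 < \<delta> / (of_int (q * Q))\<^sup>2"
      using x(2) Q \<delta> by simp
    ultimately show False by linarith
  qed
  with Q avoid show ?thesis unfolding Bad_def by blast
qed

lemma translate_iff: "x \<in> translate E r \<longleftrightarrow> x - r \<in> E"
  unfolding translate_def by (force intro: exI[of _ "x - r"])

text \<open>The steps \<open>n = k N + i\<close> cover all large denominators, since consecutive ranges overlap.\<close>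

lemma denominator_range:
  fixes b l \<delta> x :: real and N i :: nat
  assumes b: "1 < b" "b ^ N * (6 * \<delta>) \<le> 1" and l: "0 < l" and N: "0 < N"
    and x: "6 * \<delta> * b ^ i \<le> l * x"
  shows "\<exists>k. 6 * \<delta> \<le> l / b ^ (k * N + i) * x \<and> l / b ^ (k * N + i) * x \<le> 1"
proof -
  let ?P = "\<lambda>k. l / b ^ (k * N + i) * x \<le> 1"
  obtain k0 where k0: "l * x < b ^ k0"
    using real_arch_pow[OF b(1)] by blast
  have "b ^ k0 \<le> b ^ (k0 * N + i)"
    using b(1) N by (intro power_increasing) (auto simp: trans_le_add1)
  then have P0: "?P k0"
    using k0 b(1) by (simp add: pos_divide_le_eq del: power_increasing_iff)
  define k where "k = (LEAST k. ?P k)"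
  have Pk: "?P k"
    unfolding k_def by (rule LeastI[of ?P, OF P0])
  \<comment> \<open>For \<open>k = 0\<close> this is the assumption on \<open>x\<close>. Otherwise
    the value at \<open>k - 1\<close> exceeds 1, and \<open>N\<close> further levels divide it by
    \<open>b ^ N\<close>, which is at most \<open>1 / (6 * \<delta>)\<close>.\<close>
  have "6 * \<delta> \<le> l / b ^ (k * N + i) * x"
  proof (cases k)
    case 0
    then show ?thesis using x b(1) by (simp add: pos_le_divide_eq)
  next
    case (Suc j)
    then have "\<not> ?P j"
      using not_less_Least[of j ?P] unfolding k_def by simp
    then have "1 < l / b ^ (j * N + i) * x" by simp
    also have "\<dots> = b ^ N * (l / b ^ (k * N + i) * x)"
      using b(1) by (simp add: Suc power_add)
    finally have "b ^ N * (6 * \<delta>) < b ^ N * (l / b ^ (k * N + i) * x)"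
      using b(2) by linarith
    then show ?thesis
      using b(1) by (simp only: mult_less_cancel_left_pos zero_less_power order.strict_trans[OF zero_less_one])
  qed
  with Pk show ?thesis by blast
qed

text \<open>The start \<open>a\<close> and the length \<open>l\<close> stay free so that one
  construction gives both density (short cells anywhere) and dimension
  (\<open>l = 1\<close>).\<close>

lemma exists_cell_tree:
  fixes r :: "nat \<Rightarrow> real" and a l \<delta> :: real
  assumes M: "1 \<le> M" and l: "0 < l" and N: "1 \<le> N"
    and \<delta>: "0 < \<delta>" "(3 * real M) ^ N * (6 * \<delta>) \<le> 1"
  shows "\<exists>A. cell_tree M (3 * real M) l A \<and> A 0 0 = a \<and>
    (\<forall>t\<ge>0. cell_tree.point M A t \<in> (\<Inter>i\<in>{1..N}. translate (Bad \<delta>) (r i)))"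
proof -
  define b where "b = 3 * real M"
  have b: "1 < b" unfolding b_def using M by simp
  define L where "L m = l / b ^ m" for m
  have L: "0 < L m" for m
    unfolding L_def using b l by simp
  have L_Suc: "L (Suc m) * real M = L m / 3" for m
    unfolding L_def b_def using M by simp
  \<comment> \<open>The translates are treated cyclically: level \<open>m\<close> serves index
    \<open>m mod N + 1\<close>, so \<open>r i\<close> has its turn at the levels
    \<open>k * N + (i - 1)\<close>.\<close>
  define good where "good m a c \<longleftrightarrow> a \<le> c \<and> c + L m / 3 \<le> a + L m \<and>
    (\<forall>y\<in>{c..c + L m / 3}. \<forall>p q::int. 0 < q \<longrightarrow> 6 * \<delta> \<le> L m * (of_int q)\<^sup>2 \<longrightarrow>
      L m * (of_int q)\<^sup>2 \<le> 1 \<longrightarrow> \<delta> / (of_int q)\<^sup>2 \<le> \<bar>y - r (m mod N + 1) - of_int p / of_int q\<bar>)"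
    for m a c
  have "\<exists>c. good m a c" for m a
    unfolding good_def by (rule third_avoiding_fractions[OF L])
  then obtain c where "\<And>m a. good m a (c m a)"
    by metis
  then obtain c where c: "\<And>m a. a \<le> c m a" "\<And>m a. c m a + L m / 3 \<le> a + L m"
    "\<And>m a y p q. y \<in> {c m a..c m a + L m / 3} \<Longrightarrow> 0 < q \<Longrightarrow> 6 * \<delta> \<le> L m * (of_int q)\<^sup>2 \<Longrightarrow>
      L m * (of_int q)\<^sup>2 \<le> 1 \<Longrightarrow> \<delta> / (of_int q)\<^sup>2 \<le> \<bar>y - r (m mod N + 1) - of_int p / of_int q\<bar>"
    unfolding good_def by blast
  \<comment> \<open>Roots are consecutive intervals of length \<open>l\<close> from \<open>a\<close>
    on. The good third of each cell is cut into \<open>M\<close> pieces of length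
    \<open>L (Suc m)\<close>, and \<open>j mod M\<close> is the position of the piece.\<close>
  define A where "A = rec_nat (\<lambda>j. a + real j * l)
    (\<lambda>m B j. c m (B (j div M)) + real (j mod M) * L (Suc m))"
  have A0: "A 0 j = a + real j * l" for j
    by (simp add: A_def)
  have A_Suc: "A (Suc m) j = c m (A m (j div M)) + real (j mod M) * L (Suc m)" for m j
    by (simp add: A_def)
  have in_third: "c m (A m (j div M)) \<le> A (Suc m) j"
    "A (Suc m) j + L (Suc m) \<le> c m (A m (j div M)) + L m / 3" for m j
  proof -
    show "c m (A m (j div M)) \<le> A (Suc m) j"
      using L[of "Suc m"] by (simp add: A_Suc)
    have "real (j mod M) + 1 \<le> real M"
      using M by (metis Suc_eq_plus1 Suc_leI mod_less_divisor of_nat_1 of_nat_add of_nat_le_iff less_le_trans zero_less_one)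
    then have "L (Suc m) * (real (j mod M) + 1) \<le> L (Suc m) * real M"
      using L[of "Suc m"] by simp
    also have "\<dots> = L m / 3"
      by (rule L_Suc)
    finally show "A (Suc m) j + L (Suc m) \<le> c m (A m (j div M)) + L m / 3"
      by (simp add: A_Suc algebra_simps)
  qed
  have sep: "A m i + L m \<le> A m j" if "i < j" for m i j
    using that
  proof (induction m arbitrary: i j)
    case 0
    then have "(real i + 1) * l \<le> real j * l"
      using l by (intro mult_right_mono) auto
    then show ?case by (simp add: A0 L_def algebra_simps)
  next
    case (Suc m)
    show ?case
    proof (cases "i div M = j div M")
      case True
      then have "i mod M < j mod M"
        using Suc.prems by (metis div_mult_mod_eq nat_add_left_cancel_less)
      then have "(real (i mod M) + 1) * L (Suc m) \<le> real (j mod M) * L (Suc m)"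
        using L[of "Suc m"] by (intro mult_right_mono) auto
      then show ?thesis using True by (simp add: A_Suc algebra_simps)
    next
      case False
      then have "i div M < j div M"
        using Suc.prems by (simp add: div_le_mono le_neq_implies_less)
      from Suc.IH[OF this] show ?thesis
        using in_third(2)[of m i] in_third(1)[of m j] c(1)[of "A m (j div M)" m] c(2)[of m "A m (i div M)"]
        by linarith
    qed
  qed
  interpret cell_tree M b l A
  proof
    show "A i j + l / b ^ i \<le> A i k" if "j < k" for i j k
      using sep[OF that] by (simp add: L_def)
    show "A m (j div M) \<le> A (Suc m) j" for m j
      using in_third(1) c(1) order_trans by blast
    show "A (Suc m) j + l / b ^ Suc m \<le> A m (j div M) + l / b ^ m" for m j
      using in_third(2) c(2) order_trans unfolding L_def by blast
  qed (use M b l in auto)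
  have "point t \<in> translate (Bad \<delta>) (r i)" if t: "0 \<le> t" and i: "i \<in> {1..N}" for t i
  proof -
    \<comment> \<open>Since \<open>q \<le> q\<^sup>2\<close> for \<open>q \<ge> 1\<close>, this
      threshold ensures \<open>6 * \<delta> \<le> L (i - 1) * q\<^sup>2\<close>: no such
      \<open>q\<close> is too small for the first level that treats \<open>r i\<close>.\<close>
    define Q where "Q = max 1 \<lceil>6 * \<delta> * b ^ (i - 1) / l\<rceil>"
    have "\<delta> / (of_int q)\<^sup>2 \<le> \<bar>point t - r i - of_int p / of_int q\<bar>" if q: "Q \<le> q" for p q
    proof -
      have "6 * \<delta> * b ^ (i - 1) / l \<le> of_int q" and q1: "1 \<le> q"
        using q unfolding Q_def by (simp_all add: ceiling_le_iff)
      moreover have "of_int q \<le> (of_int q :: real)\<^sup>2"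
        using q1 by (simp add: power2_eq_square)
      ultimately have "6 * \<delta> * b ^ (i - 1) / l \<le> (of_int q)\<^sup>2"
        by linarith
      then have "6 * \<delta> * b ^ (i - 1) \<le> l * (of_int q)\<^sup>2"
        using l by (simp add: field_simps)
      from denominator_range[OF b _ l _ this] obtain k where
        k: "6 * \<delta> \<le> L (k * N + (i - 1)) * (of_int q)\<^sup>2" "L (k * N + (i - 1)) * (of_int q)\<^sup>2 \<le> 1"
        using \<delta>(2) N unfolding b_def[symmetric] L_def by auto
      define m where "m = k * N + (i - 1)"
      have m: "m mod N + 1 = i"
        unfolding m_def using i by (simp only: mod_mult_self3) auto
      \<comment> \<open>The cell of level \<open>Suc m\<close> containing the point lies inside the
        third chosen at level \<open>m\<close>.\<close>
      have "point t \<in> {c m (A m (cell_index t m))..c m (A m (cell_index t m)) + L m / 3}"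
        using point_in_cell[OF t, of "Suc m"] in_third[of m "cell_index t (Suc m)"]
        unfolding L_def[symmetric] cell_index_Suc_div[OF t] by auto
      from c(3)[OF this, of q p] q1 k show ?thesis
        unfolding m_def[symmetric] m by simp
    qed
    then have "point t - r i \<in> Bad \<delta>"
      using \<delta>(1) by (intro BadI[of Q]) (auto simp: Q_def)
    then show ?thesis by (simp add: translate_iff)
  qed
  moreover have "A 0 0 = a" by (simp add: A0)
  ultimately show ?thesis
    using cell_tree_axioms unfolding b_def by blast
qed

section \<open>Density and the dimension bound\<close>

theorem theorem1p13:
  fixes N :: nat and r :: "nat \<Rightarrow> real" and \<delta> :: real
  assumes "N \<ge> 1"
    and "0 < \<delta>"
    and "\<delta> < 3 powr (1 - real N) / 18"
  shows "closure (\<Inter>i\<in>{1..N}. translate (Bad \<delta>) (r i)) = UNIV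
    \<and> hausdorff_dim (\<Inter>i\<in>{1..N}. translate (Bad \<delta>) (r i))
        \<ge> ereal (real N * ln (real_of_int \<lfloor>(1 / (18 * \<delta> * 3 ^ (N - 1))) powr (1 / real N)\<rfloor>)
                  / ln (1 / (6 * \<delta>)))"
proof
  let ?E = "\<Inter>i\<in>{1..N}. translate (Bad \<delta>) (r i)"
  let ?K = "1 / (18 * \<delta> * 3 ^ (N - 1))"
  have "(3::real) powr (1 - real N) = 1 / 3 ^ (N - 1)"
    using assms(1) powr_realpow[of "3::real" "N - 1"] powr_minus[of "3::real" "real (N - 1)"]
    by (simp add: of_nat_diff inverse_eq_divide)
  then have "18 * \<delta> < 1 / 3 ^ (N - 1)"
    using assms(3) by simp
  then have K: "1 \<le> ?K"
    using assms(2) by (simp add: pos_less_divide_eq)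
  \<comment> \<open>The largest integer with \<open>M ^ N \<le> ?K\<close>, that is, with
    \<open>(3 * M) ^ N * (6 * \<delta>) \<le> 1\<close>. The hypothesis on \<delta> says
    \<open>?K > 1\<close>, which makes \<open>M\<close> positive.\<close>
  define M where "M = nat \<lfloor>?K powr (1 / real N)\<rfloor>"
  have "1 \<le> ?K powr (1 / real N)"
    using K by (intro ge_one_powr_ge_zero) auto
  then have M: "1 \<le> M" and M_eq: "real_of_int \<lfloor>?K powr (1 / real N)\<rfloor> = real M"
    unfolding M_def by (simp_all add: le_nat_iff le_floor_iff)
  have "real M ^ N \<le> (?K powr (1 / real N)) ^ N"
    unfolding M_eq[symmetric] by (rule power_mono[OF of_int_floor_le]) (simp add: M_eq)
  also have "\<dots> = ?K"
    using K assms(1,2) by (simp only: powr_power) simp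
  finally have "real M ^ N \<le> ?K" .
  moreover have "(3::real) ^ N = 3 * 3 ^ (N - 1)"
    using assms(1) by (cases N) auto
  ultimately have M_pow: "(3 * real M) ^ N * (6 * \<delta>) \<le> 1"
    using assms(2) by (simp add: power_mult_distrib field_simps)
  note tree = exists_cell_tree[OF M _ assms(1,2) M_pow, of _ _ r]
  show "closure ?E = UNIV"
  proof -
    have "x \<in> closure ?E" for x
    proof (subst closure_approachable, intro allI impI)
      fix e :: real assume e: "0 < e"
      then obtain A where A: "cell_tree M (3 * real M) (e / 2) A" "A 0 0 = x"
        "cell_tree.point M A 0 \<in> ?E"
        using tree[of "e / 2" x] by auto
      interpret cell_tree M "3 * real M" "e / 2" A by fact
      \<comment> \<open>Parameter 0 belongs to root 0, the interval
        \<open>[x, x + e / 2]\<close>.\<close>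
      have "dist (point 0) x < e"
        using point_in_cell[of 0 0] A(2) e by (simp add: cell_index_def dist_real_def)
      with A(3) show "\<exists>y\<in>?E. dist y x < e" by blast
    qed
    then show ?thesis by blast
  qed
  obtain A where A: "cell_tree M (3 * real M) 1 A" "\<And>t. 0 \<le> t \<Longrightarrow> cell_tree.point M A t \<in> ?E"
    using tree[of 1 0] by auto
  interpret cell_tree M "3 * real M" 1 A by fact
  have "(3 * real M) ^ N \<le> 1 / (6 * \<delta>)"
    using M_pow assms(2) by (simp add: field_simps)
  then have "ln ((3 * real M) ^ N) \<le> ln (1 / (6 * \<delta>))"
    using M assms(2) by (subst ln_le_cancel_iff) auto
  then have le: "real N * ln (3 * real M) \<le> ln (1 / (6 * \<delta>))"
    using M by (subst (asm) ln_realpow) auto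
  have pos: "0 < real N * ln (3 * real M)"
    using M assms(1) by simp
  \<comment> \<open>The numerator is nonnegative, so the smaller denominator from \<open>le\<close>
    increases the quotient; the factor \<open>N\<close> then cancels.\<close>
  have "real N * ln (real M) / ln (1 / (6 * \<delta>)) \<le> real N * ln (real M) / (real N * ln (3 * real M))"
    using M pos le less_le_trans[OF pos le] by (intro divide_left_mono mult_pos_pos[of _ "real N * _"] mult_nonneg_nonneg) auto
  also have "\<dots> = ln (real M) / ln (3 * real M)"
    using assms(1) by simp
  finally have "ereal (real N * ln (real M) / ln (1 / (6 * \<delta>))) \<le> ereal (ln (real M) / ln (3 * real M))"
    by simp
  also have "\<dots> \<le> hausdorff_dim ?E"
    using A(2) by (intro hausdorff_dim_ge) auto
  finally show "ereal (real N * ln (real_of_int \<lfloor>?K powr (1 / real N)\<rfloor>) / ln (1 / (6 * \<delta>))) \<le> hausdorff_dim ?E"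
    unfolding M_eq .
qed

end
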